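(* Let $m\ge 1$ be an integer, $t_1,\dots,t_m\in\mathbb{R}$ with $t_m>0$, and $\lambda>-1$. Then for every $n\ge 1$ the recurrence coefficients $\beta_n$ of the monic orthogonal polynomials with respect to the weight $w(x;T_m;\lambda)=|x|^{2\lambda+1}\exp\bigl(-\sum_{k=1}^m t_kx^{2k}\bigr)$ on $\mathbb{R}$ satisfy the nonlinear difference equation of order $2m-2$ $$\sum_{k=1}^{m}2kt_k\,F_{k,n}(\beta_{n-k+1},\beta_{n-k+2},\dots,\beta_{n+k-2},\beta_{n+k-1})-\Bigl(\lambda+\tfrac12\Bigr)\bigl(1-(-1)^n\bigr)=n$$ (the $(m-1)$-th member of the discrete Painlevé I hierarchy), where the $F_{k,n}$ are given recursively by $$F_{1,n}=\beta_n,$$ $$F_{k,n}=F_{1,n}\bigl(F_{k-1,n-1}+2F_{k-1,n}+F_{k-1,n+1}\bigr)+F_{1,n}\sum_{\substack{i+j=k-1\\1\le i,j\le k-2}}(F_{i,n}+F_{i,n+1})(F_{j,n-1}+F_{j,n})-\sum_{\substack{i+j=k\\1\le i,j\le k-1}}F_{i,n}F_{j,n},\qquad k=2,\dots,m.$$ Moreover, for each $k$, $F_{k,n}$ is a polynomial in $\beta_{n-k+1},\dots,\beta_n,\dots,\beta_{n+k-1}$ all of whose coefficients are non-negative integers.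
   Context: Let $T_m=(t_1,\dots,t_m)$ and $w(x;T_m;\lambda)=|x|^{2\lambda+1}\exp(-\sum_{k=1}^m t_kx^{2k})$, $x\in\mathbb{R}\setminus\{0\}$. Let $P_n(x)=P_n(x;T_m;\lambda)$, $n\ge 0$, be the monic polynomials of degree $n$ that are orthogonal with respect to $w(x;T_m;\lambda)\,dx$ on $\mathbb{R}$. Since $w$ is even, they satisfy $xP_n(x)=P_{n+1}(x)+\beta_nP_{n-1}(x)$ with $P_0=1$, $P_{-1}=0$, $\beta_0=0$; this defines the recurrence coefficients $\beta_n=\beta_n(T_m;\lambda)$. Convention: $\beta_j=0$ for $j\le 0$. Empty sums are zero. The phrase "$(m-1)$-th member of the discrete Painlevé I hierarchy" is just a name for the displayed equation. *)

theory Defs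
  imports "HOL-Analysis.Analysis" "HOL-Computational_Algebra.Polynomial" "HOL-Library.Poly_Mapping"
begin

text \<open>The index \<open>k\<close> of \<open>t\<close> runs over \<open>1..m\<close>; other values of \<open>t\<close> are irrelevant. The value at
  \<open>x = 0\<close> is a junk value on a null set.\<close>

definition freud_weight :: "nat \<Rightarrow> (nat \<Rightarrow> real) \<Rightarrow> real \<Rightarrow> real \<Rightarrow> real" where
  "freud_weight m t lam x = \<bar>x\<bar> powr (2 * lam + 1) * exp (- (\<Sum>k=1..m. t k * x ^ (2 * k)))"

text \<open>Only used for weights all of whose moments are finite, as is the case for \<open>freud_weight m t lam\<close>
  with \<open>m \<ge> 1\<close>, \<open>t m > 0\<close> and \<open>lam > -1\<close>. Then the integrals below are genuine.\<close>

definition monic_orthogonal_polys :: "(real \<Rightarrow> real) \<Rightarrow> (nat \<Rightarrow> real poly) \<Rightarrow> bool" where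
  "monic_orthogonal_polys w P \<longleftrightarrow>
     (\<forall>n. degree (P n) = n \<and> lead_coeff (P n) = 1) \<and>
     (\<forall>i j. i \<noteq> j \<longrightarrow> (\<integral>x. poly (P i) x * poly (P j) x * w x \<partial>lborel) = 0)"

text \<open>Indexed by integers so that \<open>\<beta>\<^sub>j = 0\<close> for \<open>j \<le> 0\<close> can be expressed.\<close>

definition recurrence_coeff :: "(nat \<Rightarrow> real poly) \<Rightarrow> int \<Rightarrow> real" where
  "recurrence_coeff P n =
     (if n \<le> 0 then 0
      else THE b. [:0, 1:] * P (nat n) = P (nat n + 1) + smult b (P (nat n - 1)))"

text \<open>Real polynomials in formal variables indexed by the integers: finitely supported maps from
  monomials (finitely supported exponent vectors) to coefficients, with convolution product.\<close>

type_synonym mpoly = "(int \<Rightarrow>\<^sub>0 nat) \<Rightarrow>\<^sub>0 real"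

definition mvar :: "int \<Rightarrow> mpoly" where
  "mvar j = Poly_Mapping.single (Poly_Mapping.single j 1) 1"

definition mconst :: "real \<Rightarrow> mpoly" where
  "mconst c = Poly_Mapping.single 0 c"

definition mvars :: "mpoly \<Rightarrow> int set" where
  "mvars p = (\<Union>mon\<in>Poly_Mapping.keys p. Poly_Mapping.keys mon)"

definition meval :: "(int \<Rightarrow> real) \<Rightarrow> mpoly \<Rightarrow> real" where
  "meval b p = (\<Sum>mon\<in>Poly_Mapping.keys p. Poly_Mapping.lookup p mon *
                  (\<Prod>j\<in>Poly_Mapping.keys mon. b j ^ Poly_Mapping.lookup mon j))"

text \<open>The order of the difference equation given by a nonconstant polynomial \<open>p\<close>: the difference
  between the largest and the smallest index occurring in it.\<close>

definition difference_order :: "mpoly \<Rightarrow> int" where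
  "difference_order p = Max (mvars p) - Min (mvars p)"

text \<open>The polynomials \<open>F\<^sub>k\<^sub>,\<^sub>n\<close> for \<open>k \<ge> 1\<close>. In the two convolution sums \<open>j\<close> is eliminated by
  \<open>j = k - 1 - i\<close> and \<open>j = k - i\<close> respectively. The variables of nonpositive index are kept as
  formal variables here; they become 0 on evaluation at \<open>recurrence_coeff P\<close>.\<close>

fun dPI_F :: "nat \<Rightarrow> int \<Rightarrow> mpoly" where
  "dPI_F k n =
     (if k = 0 then 0
      else if k = 1 then mvar n
      else mvar n * (dPI_F (k - 1) (n - 1) + 2 * dPI_F (k - 1) n + dPI_F (k - 1) (n + 1))
         + mvar n * (\<Sum>i=1..k - 2. (dPI_F i n + dPI_F i (n + 1))
                                   * (dPI_F (k - 1 - i) (n - 1) + dPI_F (k - 1 - i) n))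
         - (\<Sum>i=1..k - 1. dPI_F i n * dPI_F (k - i) n))"

declare dPI_F.simps [simp del]

end

theory Submission
  imports Defs "HOL-Computational_Algebra.Formal_Power_Series" "HOL-Real_Asymp.Real_Asymp"
begin

text \<open>
  Let \<open>J\<close> be the bi-infinite Jacobi matrix with upper entries \<open>1\<close> and formal lower entries \<open>b\<^sub>j\<close>.
  Then \<open>F\<^sub>k\<^sub>,\<^sub>n\<close> is the entry \<open>(n, n - 1)\<close> of \<open>J\<^sup>2\<^sup>k\<^sup>-\<^sup>1\<close>, that is, a sum over lattice paths of products of
  variables; integrality, positivity and the range of the variables are then immediate. The quadratic
  recursion of the \<open>F\<^sub>k\<^sub>,\<^sub>n\<close> is an identity between the Green functions at \<open>n - 1\<close> and \<open>n\<close>, which expresses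
  that a path can only pass from one side of this edge to the other by crossing it.

  On the analytic side, let \<open>h\<^sub>n\<close> be the squared norm of \<open>P\<^sub>n\<close>. Then \<open>h\<^sub>n\<^sub>-\<^sub>1 F\<^sub>k\<^sub>,\<^sub>n\<close> at \<open>b = \<beta>\<close> is the integral of
  \<open>x\<^sup>2\<^sup>k\<^sup>-\<^sup>1 P\<^sub>n P\<^sub>n\<^sub>-\<^sub>1 w\<close>, since \<open>\<beta>\<^sub>0 = 0\<close> decouples the two halves of \<open>J\<close>. Integrating the derivative of
  \<open>P\<^sub>n P\<^sub>n\<^sub>-\<^sub>1 w\<close> gives the difference equation.
\<close>

subsection \<open>Lattice paths and their Green functions\<close>

text \<open>The entry \<open>(n, j)\<close> of \<open>J\<^sup>k\<close>: the paths of \<open>k\<close> steps \<open>\<plusminus>1\<close> from \<open>n\<close> to \<open>j\<close>, where the step from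
  \<open>i\<close> down to \<open>i - 1\<close> has weight \<open>b i\<close> and steps up have weight \<open>1\<close>.\<close>

primrec path_weight :: "(int \<Rightarrow> 'a::comm_ring_1) \<Rightarrow> nat \<Rightarrow> int \<Rightarrow> int \<Rightarrow> 'a" where
  "path_weight b 0 n j = (if n = j then 1 else 0)"
| "path_weight b (Suc k) n j = path_weight b k n (j - 1) + b (j + 1) * path_weight b k n (j + 1)"

text \<open>The definition splits off the last step of a path. Reversal exchanges last and first
  steps, so the first one has to be split off as well.\<close>

lemma path_weight_first_step:
  "path_weight b (Suc k) n j = b n * path_weight b k (n - 1) j + path_weight b k (n + 1) j"
proof (induction k arbitrary: j)
  case (Suc k)
  then show ?case
    by (simp only: path_weight.simps(2)[of b "Suc k"] Suc.IH) (simp add: algebra_simps)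
qed auto

text \<open>Read backwards, a path from \<open>n\<close> up to \<open>n + d\<close> has its up and
  down steps exchanged. Its surplus of \<open>d\<close> up steps of weight 1 turns into down steps
  from \<open>n + 1, ..., n + d\<close>, whose weights form the product.\<close>

lemma path_weight_reverse:
  "(\<Prod>i<d. b (n + 1 + int i)) * path_weight b k n (n + int d) = path_weight b k (n + int d) n"
proof (induction k arbitrary: n d)
  case (Suc k)
  show ?case
  proof (cases d)
    case (Suc e)
    let ?p = "\<lambda>d. \<Prod>i<d. b (n + 1 + int i)"
    have "path_weight b (Suc k) (n + int d) n
        = b (n + int d) * path_weight b k (n + int e) n + path_weight b k (n + int (Suc d)) n"
      using Suc by (simp add: path_weight_first_step algebra_simps del: path_weight.simps)
    also have "\<dots> = b (n + int d) * (?p e * path_weight b k n (n + int e))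
        + ?p (Suc d) * path_weight b k n (n + int (Suc d))"
      by (simp only: Suc.IH)
    also have "\<dots> = ?p d * path_weight b (Suc k) n (n + int d)"
      using Suc by (simp add: algebra_simps)
    finally show ?thesis by simp
  qed simp
qed auto

corollary path_weight_reverse_edge:
  "b n * path_weight b k (n - 1) n = path_weight b k n (n - 1)"
  using path_weight_reverse[where d = 1 and b = b and n = "n - 1" and k = k] by simp

lemma path_weight_odd: "odd (int k + n + j) \<Longrightarrow> path_weight b k n j = 0"
proof (induction k arbitrary: j)
  case (Suc k)
  have "path_weight b k n (j - 1) = 0" "path_weight b k n (j + 1) = 0"
    by (rule Suc.IH, use Suc.prems in presburger)+
  then show ?case by simp
qed auto

lemma path_weight_far: "\<bar>n - j\<bar> > int k \<Longrightarrow> path_weight b k n j = 0"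
proof (induction k arbitrary: j)
  case (Suc k)
  have "path_weight b k n (j - 1) = 0" "path_weight b k n (j + 1) = 0"
    by (rule Suc.IH, use Suc.prems in linarith)+
  then show ?case by simp
qed auto

text \<open>The last step into \<open>n\<close> comes from below with weight 1 or from above with
  weight \<open>b (n + 1)\<close>; in the second case reversal absorbs this weight. Diagonal entries
  are thereby expressed through entries below the diagonal.\<close>

lemma path_weight_return:
  "path_weight b (Suc k) n n = path_weight b k n (n - 1) + path_weight b k (n + 1) n"
  using path_weight_reverse_edge[where b = b and n = "n + 1" and k = k] by simp

section \<open>The resolvent of the Jacobi matrix as a formal power series\<close>

definition green :: "(int \<Rightarrow> 'a::comm_ring_1) \<Rightarrow> int \<Rightarrow> int \<Rightarrow> 'a fps" where
  "green b n j = Abs_fps (\<lambda>k. path_weight b k n j)"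

lemma green_nth [simp]: "fps_nth (green b n j) k = path_weight b k n j"
  by (simp add: green_def)

lemma green_rec:
  "green b n j = (if n = j then 1 else 0)
     + fps_X * (green b n (j - 1) + fps_const (b (j + 1)) * green b n (j + 1))"
proof (rule fps_ext)
  fix k
  show "fps_nth (green b n j) k = fps_nth ((if n = j then 1 else 0)
     + fps_X * (green b n (j - 1) + fps_const (b (j + 1)) * green b n (j + 1))) k"
    by (cases k) auto
qed

text \<open>Because of the factor \<open>fps_X\<close>, the coefficient of order
  \<open>k + 1\<close> at \<open>j\<close> depends only on coefficients of order \<open>k\<close> at
  the two neighbours. Induction on the order, for all sites at once, gives zero.\<close>

lemma half_line_solution_unique:
  fixes v :: "int \<Rightarrow> 'a::comm_ring_1 fps"
  assumes "v n = 0"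
    and rec: "\<And>j. j > n \<Longrightarrow> v j = fps_X * (v (j - 1) + fps_const (b (j + 1)) * v (j + 1))"
    and "j \<ge> n"
  shows "v j = 0"
proof -
  have "fps_nth (v j) k = 0" if "j \<ge> n" for k j
    using that
  proof (induction k arbitrary: j)
    case 0
    then show ?case
      using rec[of j] \<open>v n = 0\<close> by (cases "j = n") auto
  next
    case (Suc k)
    have "fps_nth (v j) (Suc k) = fps_nth (v (j - 1)) k + b (j + 1) * fps_nth (v (j + 1)) k" if "j > n"
      by (subst rec[OF that]) simp
    then show ?case
      using Suc \<open>v n = 0\<close> by (cases "j = n") auto
  qed
  then show ?thesis using \<open>j \<ge> n\<close> by (intro fps_ext) auto
qed

text \<open>The 2 x 2 minor of the resolvent at the sites \<open>n - 1\<close> and \<open>n\<close>,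
  times \<open>fps_X\<close>, is its entry \<open>(n - 1, n)\<close>. Multiplication by
  \<open>b n\<close> and reversal turn every entry \<open>(n - 1, n)\<close> into the entry
  \<open>(n, n - 1)\<close>.\<close>

lemma green_quadratic:
  "fps_const (b n) * fps_X * (green b n n * green b (n - 1) (n - 1))
     = green b n (n - 1) + fps_X * (green b n (n - 1) * green b n (n - 1))"
proof -
  \<comment> \<open>Weighted so that \<open>v n = 0\<close>; then \<open>v\<close> vanishes on the whole half line above \<open>n\<close>, and the
    equation at \<open>n\<close> itself determines \<open>v (n - 1)\<close>.\<close>
  define v where "v j = green b n n * green b (n - 1) j - green b (n - 1) n * green b n j" for j
  \<comment> \<open>The rows \<open>n - 1\<close> and \<open>n\<close> of the resolvent solve the
    same recursion in \<open>j\<close>, each with a unit source at its own site. The factors of the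
    combination do not depend on \<open>j\<close>, so they only rescale the sources.\<close>
  have rec: "v j = (if j = n - 1 then green b n n else 0) - (if j = n then green b (n - 1) n else 0)
      + fps_X * (v (j - 1) + fps_const (b (j + 1)) * v (j + 1))" for j
  proof -
    have "v j = green b n n * ((if n - 1 = j then 1 else 0)
           + fps_X * (green b (n - 1) (j - 1) + fps_const (b (j + 1)) * green b (n - 1) (j + 1)))
         - green b (n - 1) n * ((if n = j then 1 else 0)
           + fps_X * (green b n (j - 1) + fps_const (b (j + 1)) * green b n (j + 1)))"
      unfolding v_def by (subst green_rec[of b "n - 1" j], subst green_rec[of b n j]) simp
    then show ?thesis
      by (auto simp: v_def algebra_simps)
  qed
  have "v n = 0" by (simp add: v_def mult.commute)
  then have "v (n + 1) = 0"
    by (rule half_line_solution_unique[where n = n and b = b]) (subst rec, simp, simp)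
  then have up: "green b (n - 1) n = fps_X * v (n - 1)"
    using rec[of n] \<open>v n = 0\<close> by simp
  have down: "fps_const (b n) * green b (n - 1) n = green b n (n - 1)"
    by (rule fps_ext) (simp add: path_weight_reverse_edge)
  have "green b n (n - 1) = fps_const (b n) * fps_X * v (n - 1)"
    using up down by (simp add: mult_ac)
  also have "\<dots> = fps_const (b n) * fps_X * (green b n n * green b (n - 1) (n - 1))
      - fps_X * (fps_const (b n) * green b (n - 1) n * green b n (n - 1))"
    by (simp add: v_def algebra_simps)
  finally show ?thesis unfolding down by (simp add: algebra_simps)
qed

section \<open>The quadratic recursion, coefficient by coefficient\<close>

lemma sum_even_indices:
  fixes f :: "nat \<Rightarrow> 'a::comm_monoid_add"
  assumes "\<And>i. odd i \<Longrightarrow> f i = 0"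
  shows "(\<Sum>i=0..2 * k. f i) = (\<Sum>i=0..k. f (2 * i))"
  by (induction k) (simp_all add: assms)

lemma sum_odd_indices:
  fixes f :: "nat \<Rightarrow> 'a::comm_monoid_add"
  assumes "\<And>i. even i \<Longrightarrow> f i = 0"
  shows "(\<Sum>i=0..2 * k. f i) = (\<Sum>i=1..k. f (2 * i - 1))"
  by (induction k) (simp_all add: assms add.commute)

definition F_path :: "(int \<Rightarrow> 'a::comm_ring_1) \<Rightarrow> nat \<Rightarrow> int \<Rightarrow> 'a" where
  "F_path b k n = (if k = 0 then 0 else path_weight b (2 * k - 1) n (n - 1))"

lemma path_weight_return_F:
  "k \<ge> 1 \<Longrightarrow> path_weight b (2 * k) n n = F_path b k n + F_path b k (n + 1)"
  using path_weight_return[of b "2 * k - 1" n] by (simp add: F_path_def del: path_weight.simps)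

text \<open>This is the coefficient of order \<open>2 * k + 1\<close> in
  \<open>green_quadratic\<close>. By parity, only even lengths survive in the product of diagonal
  entries and only odd lengths in the square of the entry \<open>(n, n - 1)\<close>.\<close>

lemma F_path_quadratic:
  "b n * (\<Sum>i=0..k. path_weight b (2 * i) n n * path_weight b (2 * (k - i)) (n - 1) (n - 1))
     = F_path b (Suc k) n + (\<Sum>i=1..k. F_path b i n * F_path b (Suc k - i) n)"
proof -
  let ?W = "path_weight b"
  have "b n * (\<Sum>i=0..2 * k. ?W i n n * ?W (2 * k - i) (n - 1) (n - 1))
      = ?W (2 * k + 1) n (n - 1) + (\<Sum>i=0..2 * k. ?W i n (n - 1) * ?W (2 * k - i) n (n - 1))"
  proof -
    have "fps_nth (fps_const (b n) * (fps_X * (green b n n * green b (n - 1) (n - 1)))) (Suc (2 * k))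
        = fps_nth (green b n (n - 1) + fps_X * (green b n (n - 1) * green b n (n - 1))) (Suc (2 * k))"
      using green_quadratic[of b n] by (simp only: mult.assoc)
    then show ?thesis
      by (simp only: fps_mult_left_const_nth fps_add_nth fps_X_mult_nth green_nth nat.simps if_False diff_Suc_1
          ) (simp only: fps_mult_nth green_nth Suc_eq_plus1)
  qed
  also have "(\<Sum>i=0..2 * k. ?W i n n * ?W (2 * k - i) (n - 1) (n - 1))
      = (\<Sum>i=0..k. ?W (2 * i) n n * ?W (2 * k - 2 * i) (n - 1) (n - 1))"
    by (rule sum_even_indices) (simp add: path_weight_odd)
  also have "(\<Sum>i=0..2 * k. ?W i n (n - 1) * ?W (2 * k - i) n (n - 1))
      = (\<Sum>i=1..k. ?W (2 * i - 1) n (n - 1) * ?W (2 * k - (2 * i - 1)) n (n - 1))"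
    by (rule sum_odd_indices) (simp add: path_weight_odd)
  also have "\<dots> = (\<Sum>i=1..k. F_path b i n * F_path b (Suc k - i) n)"
  proof (rule sum.cong)
    fix i assume "i \<in> {1..k}"
    then have "2 * k - (2 * i - 1) = 2 * (Suc k - i) - 1" "i \<noteq> 0" "Suc k - i \<noteq> 0" by auto
    then show "?W (2 * i - 1) n (n - 1) * ?W (2 * k - (2 * i - 1)) n (n - 1)
        = F_path b i n * F_path b (Suc k - i) n"
      by (simp only: F_path_def if_False)
  qed simp
  finally show ?thesis
    by (simp add: F_path_def diff_mult_distrib2 del: path_weight.simps)
qed

lemma F_path_rec:
  assumes "k \<ge> 2"
  shows "F_path b k n =
    b n * (F_path b (k - 1) (n - 1) + 2 * F_path b (k - 1) n + F_path b (k - 1) (n + 1))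
    + b n * (\<Sum>i=1..k - 2. (F_path b i n + F_path b i (n + 1))
                           * (F_path b (k - 1 - i) (n - 1) + F_path b (k - 1 - i) n))
    - (\<Sum>i=1..k - 1. F_path b i n * F_path b (k - i) n)"
proof -
  obtain l where k: "k = Suc (Suc l)" using assms by (metis Suc_le_D numeral_2_eq_2 Suc_le_mono)
  let ?A = "\<lambda>i. path_weight b (2 * i) n n" and ?B = "\<lambda>i. path_weight b (2 * i) (n - 1) (n - 1)"
  \<comment> \<open>At both ends one factor is the empty path, of weight 1. These two terms yield
    the linear part with coefficients 1, 2, 1; the inner terms yield the first convolution.\<close>
  have "(\<Sum>i=0..Suc l. ?A i * ?B (Suc l - i))
      = ?A 0 * ?B (Suc l) + (\<Sum>i=1..l. ?A i * ?B (Suc l - i)) + ?A (Suc l) * ?B 0"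
    by (simp add: sum.atLeast_Suc_atMost[of 0 l] algebra_simps del: path_weight.simps)
  also have "(\<Sum>i=1..l. ?A i * ?B (Suc l - i))
      = (\<Sum>i=1..l. (F_path b i n + F_path b i (n + 1))
            * (F_path b (Suc l - i) (n - 1) + F_path b (Suc l - i) n))"
    by (rule sum.cong) (use path_weight_return_F[of _ b "n - 1"] in
        \<open>auto simp: path_weight_return_F simp del: path_weight.simps\<close>)
  finally have "b n * (\<Sum>i=0..Suc l. ?A i * ?B (Suc l - i))
      = b n * (F_path b (Suc l) (n - 1) + 2 * F_path b (Suc l) n + F_path b (Suc l) (n + 1))
      + b n * (\<Sum>i=1..l. (F_path b i n + F_path b i (n + 1))
            * (F_path b (Suc l - i) (n - 1) + F_path b (Suc l - i) n))"
    using path_weight_return_F[of "Suc l" b "n - 1"] path_weight_return_F[of "Suc l" b n]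
    by (simp add: algebra_simps del: path_weight.simps(2))
  with F_path_quadratic[of b n "Suc l"] show ?thesis
    by (simp add: k algebra_simps del: path_weight.simps)
qed

lemma dPI_F_eq_F_path: "dPI_F k n = F_path mvar k n"
proof (induction k arbitrary: n rule: less_induct)
  case (less k)
  consider "k = 0" | "k = 1" | "k \<ge> 2" by linarith
  then show ?case
  proof cases
    case 3
    then have "dPI_F k n =
      mvar n * (dPI_F (k - 1) (n - 1) + 2 * dPI_F (k - 1) n + dPI_F (k - 1) (n + 1))
         + mvar n * (\<Sum>i=1..k - 2. (dPI_F i n + dPI_F i (n + 1))
                                   * (dPI_F (k - 1 - i) (n - 1) + dPI_F (k - 1 - i) n))
         - (\<Sum>i=1..k - 1. dPI_F i n * dPI_F (k - i) n)"
      by (subst dPI_F.simps) simp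
    also have "\<dots> = F_path mvar k n"
      unfolding F_path_rec[OF 3]
      by (intro arg_cong2[where f = "(+)"] arg_cong2[where f = "(-)"] arg_cong2[where f = "(*)"] sum.cong refl less.IH)
        (use 3 in auto)
    finally show ?thesis .
  qed (subst dPI_F.simps, simp add: F_path_def)+
qed

subsection \<open>The polynomials as path sums\<close>

lemma lookup_single_mult:
  fixes a :: "'a::cancel_comm_monoid_add" and p :: "'a \<Rightarrow>\<^sub>0 'b::comm_semiring_0"
  shows "Poly_Mapping.lookup (Poly_Mapping.single a c * p) (a + mon) = c * Poly_Mapping.lookup p mon"
  by (simp add: lookup_mult lookup_single when_mult)

lemma mvar_mult_lookup:
  "Poly_Mapping.lookup (mvar j * p) (Poly_Mapping.single j 1 + mon) = Poly_Mapping.lookup p mon"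
  by (simp add: mvar_def lookup_single_mult)

lemma lookup_mconst_mult: "Poly_Mapping.lookup (mconst c * p) mon = c * Poly_Mapping.lookup p mon"
  using lookup_single_mult[of 0 c p mon] by (simp add: mconst_def)

lemma keys_mvar_mult:
  "Poly_Mapping.keys (mvar j * p) = (+) (Poly_Mapping.single j 1) ` Poly_Mapping.keys p"
proof
  show "Poly_Mapping.keys (mvar j * p) \<subseteq> (+) (Poly_Mapping.single j 1) ` Poly_Mapping.keys p"
    using keys_mult[of "mvar j" p] by (auto simp: mvar_def)
qed (auto simp: in_keys_iff mvar_mult_lookup[simplified])

lemma lookup_mvar_mult_Nats:
  assumes "\<And>mon. Poly_Mapping.lookup p mon \<in> \<nat>"
  shows "Poly_Mapping.lookup (mvar j * p) mon \<in> \<nat>"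
proof (cases "mon \<in> Poly_Mapping.keys (mvar j * p)")
  case True
  then show ?thesis using assms mvar_mult_lookup[of j p] by (auto simp: keys_mvar_mult)
qed (simp add: in_keys_iff)

text \<open>The recursion of \<open>dPI_F\<close> contains a subtraction, so positivity is read off
  the path recursion, which only adds and multiplies by variables.\<close>

lemma path_weight_mvar_Nats: "Poly_Mapping.lookup (path_weight mvar k n j) mon \<in> \<nat>"
  by (induction k arbitrary: j mon)
    (auto simp: lookup_add lookup_one when_def intro!: Nats_add lookup_mvar_mult_Nats)

lemma meval_add: "meval b (p + q) = meval b p + meval b q"
  unfolding meval_def by (rule setsum_keys_plus_distrib) (auto simp: algebra_simps)

lemma meval_mvar_mult: "meval b (mvar j * p) = b j * meval b p"
proof -
  let ?e = "Poly_Mapping.single j (1::nat)"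
  have mon: "(\<Prod>i\<in>Poly_Mapping.keys (?e + mon). b i ^ Poly_Mapping.lookup (?e + mon) i)
      = b j * (\<Prod>i\<in>Poly_Mapping.keys mon. b i ^ Poly_Mapping.lookup mon i)" for mon
  proof -
    \<comment> \<open>Over this common index set the exponents of both monomials can be added; each
      of the two resulting products then shrinks to its own keys.\<close>
    let ?S = "insert j (Poly_Mapping.keys mon)"
    have "(\<Prod>i\<in>Poly_Mapping.keys (?e + mon). b i ^ Poly_Mapping.lookup (?e + mon) i)
        = (\<Prod>i\<in>?S. b i ^ Poly_Mapping.lookup (?e + mon) i)"
      by (rule prod.mono_neutral_left) (use keys_add[of ?e mon] in \<open>auto simp: in_keys_iff\<close>)
    also have "\<dots> = (\<Prod>i\<in>?S. b i ^ Poly_Mapping.lookup ?e i)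
        * (\<Prod>i\<in>?S. b i ^ Poly_Mapping.lookup mon i)"
      by (simp only: lookup_add power_add prod.distrib)
    also have "(\<Prod>i\<in>?S. b i ^ Poly_Mapping.lookup ?e i) = (\<Prod>i\<in>{j}. b i ^ Poly_Mapping.lookup ?e i)"
      by (rule prod.mono_neutral_right) (auto simp: lookup_single when_def)
    also have "(\<Prod>i\<in>?S. b i ^ Poly_Mapping.lookup mon i)
        = (\<Prod>i\<in>Poly_Mapping.keys mon. b i ^ Poly_Mapping.lookup mon i)"
      by (rule prod.mono_neutral_right) (auto simp: in_keys_iff)
    finally show ?thesis by simp
  qed
  have "inj_on ((+) ?e) (Poly_Mapping.keys p)" by (auto simp: inj_on_def)
  then show ?thesis
    unfolding meval_def keys_mvar_mult
    by (simp only: sum.reindex o_def mon mvar_mult_lookup) (simp add: sum_distrib_left mult_ac)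
qed

lemma meval_path_weight: "meval b (path_weight mvar k n j) = path_weight b k n j"
  by (induction k arbitrary: j) (auto simp: meval_add meval_mvar_mult, auto simp: meval_def)

lemma mvars_add: "mvars (p + q) \<subseteq> mvars p \<union> mvars q"
  using keys_add[of p q] by (auto simp: mvars_def)

lemma mvars_mvar_mult: "mvars (mvar j * p) \<subseteq> insert j (mvars p)"
  using keys_add by (fastforce simp: mvars_def keys_mvar_mult split: if_splits)

lemma mvars_subset_iff:
  "mvars p \<subseteq> A \<longleftrightarrow> (\<forall>mon i. Poly_Mapping.lookup p mon \<noteq> 0 \<longrightarrow> i \<in> Poly_Mapping.keys mon \<longrightarrow> i \<in> A)"
  unfolding mvars_def UN_subset_iff subset_iff lookup_not_eq_zero_eq_in_keys by blast

lemma finite_mvars: "finite (mvars p)"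
  by (simp add: mvars_def)

text \<open>A path of \<open>k\<close> steps from \<open>n\<close> to \<open>j\<close> stays between
  \<open>(n + j - k) / 2\<close> and \<open>(n + j + k) / 2\<close>. The variable \<open>i\<close>
  belongs to the step from \<open>i\<close> to \<open>i - 1\<close>, so both sites obey these
  bounds; doubling avoids the fractions.\<close>

lemma mvars_path_weight:
  "mvars (path_weight mvar k n j) \<subseteq> {i. n + j - int k + 2 \<le> 2 * i \<and> 2 * i \<le> n + j + int k}"
proof (induction k arbitrary: j)
  case 0
  then show ?case by (auto simp: mvars_def)
next
  case (Suc k)
  let ?B = "{i. n + j - int (Suc k) + 2 \<le> 2 * i \<and> 2 * i \<le> n + j + int (Suc k)}"
  have "mvars (path_weight mvar k n (j - 1)) \<subseteq> ?B"
    using Suc.IH[of "j - 1"] by auto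
  moreover have "mvars (mvar (j + 1) * path_weight mvar k n (j + 1)) \<subseteq> ?B"
  \<comment> \<open>If \<open>k\<close> steps do not lead from \<open>n\<close> to
    \<open>j + 1\<close>, the summand vanishes; otherwise the new variable \<open>j + 1\<close>
    itself obeys the bounds.\<close>
  proof (cases "\<bar>n - (j + 1)\<bar> > int k")
    case True
    then show ?thesis using path_weight_far[of k n "j + 1" mvar] by (simp add: mvars_def)
  next
    case False
    then have "insert (j + 1) (mvars (path_weight mvar k n (j + 1))) \<subseteq> ?B"
      using Suc.IH[of "j + 1"] by auto
    then show ?thesis using mvars_mvar_mult by blast
  qed
  ultimately show ?case
    using mvars_add by (fastforce simp only: path_weight.simps)
qed

section \<open>Extreme variables and the order of the equation\<close>

lemma keys_path_weight_up_step:
  assumes "mon \<in> Poly_Mapping.keys (path_weight mvar k n (j - 1))"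
  shows "mon \<in> Poly_Mapping.keys (path_weight mvar (Suc k) n j)"
proof -
  let ?p = "path_weight mvar k n (j - 1)" and ?q = "mvar (j + 1) * path_weight mvar k n (j + 1)"
  \<comment> \<open>Both summands have coefficients in \<open>\<nat>\<close>, so nothing cancels and
    a monomial of either one survives in the sum.\<close>
  have "Poly_Mapping.lookup ?p mon \<in> \<nat>" "Poly_Mapping.lookup ?q mon \<in> \<nat>"
    by (intro path_weight_mvar_Nats lookup_mvar_mult_Nats)+
  then show ?thesis
    using assms by (auto simp: in_keys_iff lookup_add elim!: Nats_cases)
qed

lemma keys_path_weight_down_step:
  assumes "mon \<in> Poly_Mapping.keys (path_weight mvar k n (j + 1))"
  shows "Poly_Mapping.single (j + 1) 1 + mon \<in> Poly_Mapping.keys (path_weight mvar (Suc k) n j)"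
proof -
  let ?p = "path_weight mvar k n (j - 1)" and ?q = "mvar (j + 1) * path_weight mvar k n (j + 1)"
  let ?m = "Poly_Mapping.single (j + 1) 1 + mon"
  have "Poly_Mapping.lookup ?p ?m \<in> \<nat>" "Poly_Mapping.lookup ?q ?m \<in> \<nat>"
    by (intro path_weight_mvar_Nats lookup_mvar_mult_Nats)+
  moreover have "Poly_Mapping.lookup ?q ?m \<noteq> 0"
    using assms unfolding mvar_mult_lookup by (simp add: in_keys_iff)
  ultimately show ?thesis
    by (auto simp: in_keys_iff lookup_add elim!: Nats_cases)
qed

lemma keys_path_weight_ups:
  assumes "mon \<in> Poly_Mapping.keys (path_weight mvar k n j)"
  shows "mon \<in> Poly_Mapping.keys (path_weight mvar (k + a) n (j + int a))"
proof (induction a)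
  case (Suc a)
  then show ?case
    using keys_path_weight_up_step[of mon "k + a" n "j + int (Suc a)"] by (simp add: add_ac del: path_weight.simps)
qed (use assms in simp)

text \<open>Going straight down from \<open>j\<close> by \<open>a\<close> sites collects the
  variables \<open>j, j - 1, ..., j - a + 1\<close>, one for each step.\<close>

lemma keys_path_weight_downs:
  assumes "Poly_Mapping.keys (path_weight mvar k n j) \<noteq> {}"
  shows "\<exists>mon \<in> Poly_Mapping.keys (path_weight mvar (k + a) n (j - int a)).
           {j - int a<..j} \<subseteq> Poly_Mapping.keys mon"
proof (induction a)
  case (Suc a)
  then obtain mon where mon: "mon \<in> Poly_Mapping.keys (path_weight mvar (k + a) n (j - int a))"
    and sub: "{j - int a<..j} \<subseteq> Poly_Mapping.keys mon" by blast
  have "Poly_Mapping.single (j - int a) 1 + mon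
      \<in> Poly_Mapping.keys (path_weight mvar (k + Suc a) n (j - int (Suc a)))"
    using keys_path_weight_down_step[of mon "k + a" n "j - int (Suc a)"] mon
    by (simp add: algebra_simps del: path_weight.simps)
  moreover have "{j - int (Suc a)<..j} \<subseteq> Poly_Mapping.keys (Poly_Mapping.single (j - int a) 1 + mon)"
  proof
    fix i assume "i \<in> {j - int (Suc a)<..j}"
    then have "i = j - int a \<or> i \<in> {j - int a<..j}" by auto
    then show "i \<in> Poly_Mapping.keys (Poly_Mapping.single (j - int a) 1 + mon)"
      using sub by (auto simp: in_keys_iff lookup_add)
  qed
  ultimately show ?case by blast
next
  case 0
  show ?case using assms by (simp del: keys_eq_empty) blast
qed

lemma dPI_F_eq_path_weight: "k \<ge> 1 \<Longrightarrow> dPI_F k n = path_weight mvar (2 * k - 1) n (n - 1)"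
  by (simp add: dPI_F_eq_F_path F_path_def)

lemma meval_dPI_F: "k \<ge> 1 \<Longrightarrow> meval b (dPI_F k n) = path_weight b (2 * k - 1) n (n - 1)"
  by (simp add: dPI_F_eq_path_weight meval_path_weight)

lemma lookup_dPI_F_Nats: "k \<ge> 1 \<Longrightarrow> Poly_Mapping.lookup (dPI_F k n) mon \<in> \<nat>"
  by (simp add: dPI_F_eq_path_weight path_weight_mvar_Nats)

lemma mvars_dPI_F:
  assumes "k \<ge> 1"
  shows "mvars (dPI_F k n) \<subseteq> {n - int k + 1..n + int k - 1}"
  using mvars_path_weight[of "2 * k - 1" n "n - 1"] assms
  by (auto simp: dPI_F_eq_path_weight of_nat_diff)

text \<open>The extreme variables come from the path that first makes all its up (down) steps and then
  all its down (up) steps.\<close>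

lemma dPI_F_extreme_keys:
  assumes "k \<ge> 1"
  shows "\<exists>mon \<in> Poly_Mapping.keys (dPI_F k n). n + int k - 1 \<in> Poly_Mapping.keys mon" (is ?up)
    and "\<exists>mon \<in> Poly_Mapping.keys (dPI_F k n). n - int k + 1 \<in> Poly_Mapping.keys mon" (is ?down)
proof -
  obtain l where k: "k = Suc l" using assms by (cases k) auto
  have 0: "0 \<in> Poly_Mapping.keys (path_weight mvar 0 n n)" by simp
  have "Poly_Mapping.keys (path_weight mvar l n (n + int l)) \<noteq> {}"
    using keys_path_weight_ups[OF 0, of l] by (auto simp del: path_weight.simps)
  from keys_path_weight_downs[OF this, of k] obtain mon
    where "mon \<in> Poly_Mapping.keys (path_weight mvar (l + k) n (n + int l - int k))"
      and "{n + int l - int k<..n + int l} \<subseteq> Poly_Mapping.keys mon" by blast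
  moreover have "l + k = 2 * k - 1" "n + int l - int k = n - 1" by (auto simp: k)
  ultimately have "mon \<in> Poly_Mapping.keys (dPI_F k n)" and "{n - 1<..n + int l} \<subseteq> Poly_Mapping.keys mon"
    using \<open>k \<ge> 1\<close> by (simp_all only: dPI_F_eq_path_weight)
  moreover have "n + int k - 1 \<in> {n - 1<..n + int l}" by (simp add: k)
  ultimately show ?up by blast
  obtain mon where mon: "mon \<in> Poly_Mapping.keys (path_weight mvar k n (n - int k))"
    and sub: "{n - int k<..n} \<subseteq> Poly_Mapping.keys mon"
    using keys_path_weight_downs[of 0 n n k] 0 by auto
  have "k + l = 2 * k - 1" "n - int k + int l = n - 1" by (auto simp: k)
  then have "mon \<in> Poly_Mapping.keys (dPI_F k n)"
    using keys_path_weight_ups[OF mon, of l] \<open>k \<ge> 1\<close>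
    by (simp only: dPI_F_eq_path_weight)
  moreover have "n - int k + 1 \<in> {n - int k<..n}" by (simp add: k)
  ultimately show ?down using sub by blast
qed

text \<open>The indices \<open>n + m - 1\<close> and \<open>n - m + 1\<close> lie outside the range
  of every \<open>dPI_F k n\<close> with \<open>k < m\<close>. Their monomials thus come from the
  term \<open>k = m\<close> alone and cannot be cancelled.\<close>

lemma difference_order_combination:
  assumes "m \<ge> 1" and "c m \<noteq> 0"
  shows "difference_order (\<Sum>k=1..m. mconst (c k) * dPI_F k n) = 2 * int m - 2"
proof -
  let ?S = "\<Sum>k=1..m. mconst (c k) * dPI_F k n"
  have lookup: "Poly_Mapping.lookup ?S mon = (\<Sum>k=1..m. c k * Poly_Mapping.lookup (dPI_F k n) mon)" for mon
    by (simp add: lookup_sum lookup_mconst_mult)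
  have sub: "mvars ?S \<subseteq> {n - int m + 1..n + int m - 1}"
    unfolding mvars_subset_iff
  proof (intro allI impI)
    fix mon i assume mon: "Poly_Mapping.lookup ?S mon \<noteq> 0" "i \<in> Poly_Mapping.keys mon"
    then obtain k where k: "k \<in> {1..m}" "c k * Poly_Mapping.lookup (dPI_F k n) mon \<noteq> 0"
      unfolding lookup using sum.not_neutral_contains_not_neutral by blast
    then have "i \<in> {n - int k + 1..n + int k - 1}"
      using mvars_dPI_F[of k n, unfolded mvars_subset_iff, rule_format, of mon i] mon(2) by auto
    with k show "i \<in> {n - int m + 1..n + int m - 1}" by auto
  qed
  have extreme: "i \<in> mvars ?S"
    if "mon \<in> Poly_Mapping.keys (dPI_F m n)" "i \<in> Poly_Mapping.keys mon"
      "i \<notin> {n - int m + 2..n + int m - 2}" for i mon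
  proof -
    have "Poly_Mapping.lookup (dPI_F k n) mon = 0" if k: "k \<in> {1..m} - {m}" for k
    proof (rule ccontr)
      assume "Poly_Mapping.lookup (dPI_F k n) mon \<noteq> 0"
      then have "i \<in> {n - int k + 1..n + int k - 1}"
        using mvars_dPI_F[of k n, unfolded mvars_subset_iff, rule_format, of mon i]
          \<open>i \<in> Poly_Mapping.keys mon\<close> k by auto
      then show False using k \<open>i \<notin> _\<close> by auto
    qed
    then have "Poly_Mapping.lookup ?S mon = c m * Poly_Mapping.lookup (dPI_F m n) mon"
      unfolding lookup using assms by (subst sum.remove[of _ m]) auto
    then show ?thesis
      using that assms unfolding mvars_def by (intro UN_I[of mon]) (simp_all add: in_keys_iff)
  qed
  have "n + int m - 1 \<notin> {n - int m + 2..n + int m - 2}" "n - int m + 1 \<notin> {n - int m + 2..n + int m - 2}"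
    by auto
  then have "n + int m - 1 \<in> mvars ?S" "n - int m + 1 \<in> mvars ?S"
    using dPI_F_extreme_keys[OF \<open>m \<ge> 1\<close>, of n] extreme by blast+
  then have "Max (mvars ?S) = n + int m - 1" "Min (mvars ?S) = n - int m + 1"
    using sub by (auto intro!: Max_eqI Min_eqI simp: finite_mvars)
  then show ?thesis by (simp add: difference_order_def)
qed

subsection \<open>Moments of the weight\<close>

definition potential :: "nat \<Rightarrow> (nat \<Rightarrow> real) \<Rightarrow> real poly" where
  "potential m t = (\<Sum>k=1..m. monom (t k) (2 * k))"

lemma poly_potential: "poly (potential m t) x = (\<Sum>k=1..m. t k * x ^ (2 * k))"
  by (simp add: potential_def poly_sum poly_monom)

lemma freud_weight_eq: "freud_weight m t lam x = \<bar>x\<bar> powr (2 * lam + 1) * exp (- poly (potential m t) x)"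
  by (simp add: freud_weight_def poly_potential)

text \<open>The potential minus \<open>x\<close> has degree \<open>2 * m\<close> and leading
  coefficient \<open>t m > 0\<close>. It is positive from some point on and attains a minimum on the
  compact rest of the half line, hence is bounded below there.\<close>

lemma exp_potential_bound:
  assumes "m \<ge> 1" "t m > 0"
  obtains C where "\<And>x. x \<ge> 0 \<Longrightarrow> exp (- poly (potential m t) x) \<le> C * exp (- x)"
proof -
  let ?q = "potential m t - [:0, 1:]"
  have "coeff (potential m t) (2 * m) = (\<Sum>k=1..m. if k = m then t k else 0)"
    unfolding potential_def coeff_sum by (rule sum.cong) (auto simp: coeff_monom)
  then have coeff: "coeff ?q (2 * m) = t m"
    using assms by (simp add: coeff_pCons split: nat.split)
  have "degree (potential m t) \<le> 2 * m"
    unfolding potential_def by (intro degree_sum_le) (auto intro!: order.trans[OF degree_monom_le])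
  then have "degree ?q \<le> 2 * m"
    using assms by (intro degree_diff_le) auto
  then have "degree ?q = 2 * m"
    using coeff assms by (intro antisym le_degree) auto
  then have "lead_coeff ?q > 0" using coeff assms by simp
  then obtain N where N: "\<And>x. x \<ge> N \<Longrightarrow> poly ?q x > 0"
    using poly_pinfty_gt_lc[of ?q] by force
  have "continuous_on {0..max 0 N} (poly ?q)"
    by (rule continuous_at_imp_continuous_on) simp
  moreover have "compact {0..max 0 N}" "{0..max 0 N} \<noteq> {}" by auto
  ultimately obtain x0 where x0: "\<And>x. x \<in> {0..max 0 N} \<Longrightarrow> poly ?q x0 \<le> poly ?q x"
    using continuous_attains_inf[of "{0..max 0 N}" "poly ?q"] by blast
  have "min 0 (poly ?q x0) \<le> poly ?q x" if "x \<ge> 0" for x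
    using N[of x] x0[of x] that by (cases "x \<ge> N") (auto simp: min_def not_le simp del: poly_diff)
  then have "exp (- poly (potential m t) x) \<le> exp (- min 0 (poly ?q x0)) * exp (- x)" if "x \<ge> 0" for x
    using that by (force simp flip: exp_add)
  then show ?thesis using that by blast
qed

text \<open>The Gamma integral is given as a gauge integral. Since the integrand is non-negative it
  converges absolutely, and Borel measurability brings it from the completed measure to
  \<open>lborel\<close>.\<close>

lemma Gamma_integrand_set_integrable:
  assumes "a > -1"
  shows "set_integrable lborel {0<..} (\<lambda>x::real. x powr a * exp (- x))"
proof -
  have "(\<lambda>x. x powr a / exp x) integrable_on {0..}"
    using Gamma_integral_real[of "a + 1"] assms by (auto simp: has_integral_iff)
  then have "(\<lambda>x. x powr a / exp x) absolutely_integrable_on {0..}"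
    by (intro nonnegative_absolutely_integrable_1) auto
  then have "set_integrable lborel {0..} (\<lambda>x. x powr a / exp x)"
    unfolding set_integrable_def by (subst (asm) integrable_completion) auto
  then have "set_integrable lborel {0<..} (\<lambda>x. x powr a / exp x)"
    by (rule set_integrable_subset) auto
  then show ?thesis by (simp add: exp_minus field_simps)
qed

lemma set_integrable_sum:
  assumes "\<And>i. i \<in> I \<Longrightarrow> set_integrable M A (f i)"
  shows "set_integrable M A (\<lambda>x. \<Sum>i\<in>I. f i x)"
    and "(LINT x:A|M. (\<Sum>i\<in>I. f i x)) = (\<Sum>i\<in>I. LINT x:A|M. f i x)"
  using assms unfolding set_integrable_def set_lebesgue_integral_def
  by (simp_all add: scaleR_sum_right)

lemma half_line_set_integrable:
  assumes "m \<ge> 1" "t m > 0" "a > -1"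
  shows "set_integrable lborel {0<..} (\<lambda>x::real. x powr a * exp (- poly (potential m t) x))"
proof -
  obtain C where C: "\<And>x. x \<ge> 0 \<Longrightarrow> exp (- poly (potential m t) x) \<le> C * exp (- x)"
    using exp_potential_bound[where m = m and t = t] assms by blast
  have "set_integrable lborel {0<..} (\<lambda>x::real. C * (x powr a * exp (- x)))"
    using Gamma_integrand_set_integrable[OF assms(3)] by (rule set_integrable_mult_right)
  then show ?thesis
  proof (rule set_integrable_bound)
    show "set_borel_measurable lborel {0<..} (\<lambda>x::real. x powr a * exp (- poly (potential m t) x))"
      unfolding set_borel_measurable_def poly_potential by measurable
    show "AE x in lborel. x \<in> {0<..} \<longrightarrow> norm (x powr a * exp (- poly (potential m t) x))
        \<le> norm (C * (x powr a * exp (- x)))"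
    proof (intro AE_I2 impI)
      fix x :: real assume "x \<in> {0<..}"
      then have "x powr a * exp (- poly (potential m t) x) \<le> C * (x powr a * exp (- x))"
        using mult_left_mono[OF C[of x], of "x powr a"] by (simp add: mult_ac)
      then show "norm (x powr a * exp (- poly (potential m t) x)) \<le> norm (C * (x powr a * exp (- x)))"
        unfolding real_norm_def by (subst abs_of_nonneg) (auto intro: order.trans[OF _ abs_ge_self])
    qed
  qed
qed

definition half_moment :: "nat \<Rightarrow> (nat \<Rightarrow> real) \<Rightarrow> real \<Rightarrow> real" where
  "half_moment m t a = (LBINT x:{0<..}. x powr a * exp (- poly (potential m t) x))"

text \<open>The derivative of \<open>x powr (a + 1) * exp (- V x)\<close>, with \<open>V\<close> the
  potential, is integrated over the positive half line. The boundary term at 0 vanishes because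
  \<open>a + 1 > 0\<close>, the one at infinity by exponential decay.\<close>

lemma half_moment_rec:
  assumes m: "m \<ge> 1" "t m > 0" and a: "a > -1"
  shows "(a + 1) * half_moment m t a = (\<Sum>k=1..m. 2 * real k * t k * half_moment m t (a + 2 * real k))"
proof -
  let ?V = "potential m t"
  let ?g = "\<lambda>a x::real. x powr a * exp (- poly ?V x)"
  let ?F = "?g (a + 1)"
  let ?f = "\<lambda>x. (a + 1) * ?g a x - (\<Sum>k=1..m. 2 * real k * t k * ?g (a + 2 * real k) x)"
  obtain C where C: "\<And>x. x \<ge> 0 \<Longrightarrow> exp (- poly ?V x) \<le> C * exp (- x)"
    using exp_potential_bound[where m = m and t = t] m by blast
  note int = half_line_set_integrable[where m = m and t = t, OF m]
  have int_f: "set_integrable lborel {0<..} ?f"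
    using a by (intro set_integral_diff set_integrable_mult_right set_integrable_sum int) auto
  have ei: "einterval 0 \<infinity> = {0<..}" by (auto simp: einterval_def)
  have "(LBINT x=0..\<infinity>. ?f x) = 0 - 0"
  proof (rule interval_integral_FTC_integrable[where F = ?F])
    fix x :: real assume "0 < ereal x"
    then have x: "x > 0" by simp
    have V': "poly (pderiv ?V) x = (\<Sum>k=1..m. 2 * real k * t k * x ^ (2 * k - 1))"
      by (simp add: potential_def higher_pderiv_sum[where n = 1, simplified] pderiv_monom poly_sum poly_monom mult_ac)
    have powr: "x powr (a + 1) * x ^ (2 * k - 1) = x powr (a + 2 * real k)" if "k \<ge> 1" for k
      using x that by (simp add: powr_realpow[symmetric] of_nat_diff flip: powr_add)
    have "x powr (a + 1) * poly (pderiv ?V) x = (\<Sum>k=1..m. 2 * real k * t k * x powr (a + 2 * real k))"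
      unfolding V' sum_distrib_left
      by (rule sum.cong) (use powr in \<open>auto simp: mult.left_commute[of "x powr (a + 1)"]\<close>)
    moreover have "(\<Sum>k=1..m. 2 * real k * t k * ?g (a + 2 * real k) x)
        = (\<Sum>k=1..m. 2 * real k * t k * x powr (a + 2 * real k)) * exp (- poly ?V x)"
      by (simp add: sum_distrib_right mult.assoc)
    ultimately have f: "?f x = (a + 1) * x powr a * exp (- poly ?V x)
        - x powr (a + 1) * poly (pderiv ?V) x * exp (- poly ?V x)"
      by (simp only: mult.assoc)
    have "(?F has_real_derivative ?f x) (at x)"
      unfolding f using x by (auto intro!: derivative_eq_intros simp: algebra_simps)
    then show "(?F has_vector_derivative ?f x) (at x)"
      by (simp add: has_real_derivative_iff_has_vector_derivative)
    show "isCont ?f x"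
      using x by (intro continuous_intros) auto
  next
    show "set_integrable lborel (einterval 0 \<infinity>) ?f" using int_f unfolding ei .
    have "((\<lambda>x. x powr (a + 1)) \<longlongrightarrow> 0) (at_right 0)"
      using a by real_asymp
    moreover have "((\<lambda>x. exp (- poly ?V x)) \<longlongrightarrow> exp (- poly ?V 0)) (at_right 0)"
      by (intro tendsto_intros)
    ultimately have "(?F \<longlongrightarrow> 0 * exp (- poly ?V 0)) (at_right 0)"
      by (rule tendsto_mult)
    then show "((?F \<circ> real_of_ereal) \<longlongrightarrow> 0) (at_right 0)"
      by (simp add: zero_ereal_def ereal_tendsto_simps)
    have "((\<lambda>x. C * (x powr (a + 1) * exp (- x))) \<longlongrightarrow> C * 0) at_top"
      by (intro tendsto_mult_left) real_asymp
    then have lim: "((\<lambda>x. C * (x powr (a + 1) * exp (- x))) \<longlongrightarrow> 0) at_top" by simp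
    have "(?F \<longlongrightarrow> 0) at_top"
    proof (rule tendsto_sandwich[OF _ _ tendsto_const lim])
      show "\<forall>\<^sub>F x in at_top. ?F x \<le> C * (x powr (a + 1) * exp (- x))"
        using eventually_ge_at_top[of 0]
      proof eventually_elim
        case (elim x)
        then show ?case using mult_left_mono[OF C[of x], of "x powr (a + 1)"] by (simp add: mult_ac)
      qed
    qed auto
    then show "((?F \<circ> real_of_ereal) \<longlongrightarrow> 0) (at_left \<infinity>)"
      by (simp add: ereal_tendsto_simps)
  qed simp
  then have "0 = (LBINT x:{0<..}. ?f x)"
    using interval_integral_to_infinity_eq[of lborel 0 ?f] by (simp add: zero_ereal_def)
  also have "\<dots> = (LBINT x:{0<..}. (a + 1) * ?g a x) - (LBINT x:{0<..}. (\<Sum>k=1..m. 2 * real k * t k * ?g (a + 2 * real k) x))"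
    using a by (intro set_integral_diff set_integrable_mult_right set_integrable_sum int) auto
  also have "(LBINT x:{0<..}. (\<Sum>k=1..m. 2 * real k * t k * ?g (a + 2 * real k) x))
      = (\<Sum>k=1..m. LBINT x:{0<..}. 2 * real k * t k * ?g (a + 2 * real k) x)"
    using a by (intro set_integrable_sum set_integrable_mult_right int) auto
  finally show ?thesis by (simp add: half_moment_def)
qed


lemma freud_weight_reflect: "freud_weight m t lam (- x) = freud_weight m t lam x"
  by (simp add: freud_weight_def)

lemma freud_weight_pos: "x \<noteq> 0 \<Longrightarrow> freud_weight m t lam x > 0"
  by (simp add: freud_weight_def)

lemma freud_moment:
  assumes m: "m \<ge> 1" "t m > 0" and lam: "lam > -1"
  shows "integrable lborel (\<lambda>x. x ^ j * freud_weight m t lam x)" (is "integrable _ ?g")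
    and "(\<integral>x. x ^ j * freud_weight m t lam x \<partial>lborel)
           = (1 + (-1) ^ j) * half_moment m t (real j + (2 * lam + 1))"
proof -
  let ?a = "real j + (2 * lam + 1)"
  let ?h = "\<lambda>x. indicator {0<..} x *\<^sub>R ?g x"
  have h: "?h = (\<lambda>x. indicator {0<..} x *\<^sub>R (x powr ?a * exp (- poly (potential m t) x)))"
    by (rule ext) (auto simp: indicator_def freud_weight_eq powr_add powr_realpow)
  have int: "integrable lborel ?h"
    using half_line_set_integrable[where m = m and t = t and a = ?a] m lam
    unfolding h set_integrable_def by simp
  then have int': "integrable lborel (\<lambda>x. (-1) ^ j * ?h (- x))"
    using lborel_integrable_real_affine[OF int, of "-1" 0] by simp
  have g: "?g = (\<lambda>x. ?h x + (-1) ^ j * ?h (- x))"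
  \<comment> \<open>On each open half line only one summand is present. At \<open>x = 0\<close> both
    sides are 0, as \<open>0 powr\<close> any exponent is 0.\<close>
  proof
    fix x :: real
    have "(-1) ^ j * (- x) ^ j = x ^ j"
      by (simp flip: power_mult_distrib)
    then show "?g x = ?h x + (-1) ^ j * ?h (- x)"
      by (cases x "0::real" rule: linorder_cases)
        (auto simp: freud_weight_reflect mult.assoc[symmetric], simp add: freud_weight_def)
  qed
  show "integrable lborel ?g"
    unfolding g using int int' by (rule Bochner_Integration.integrable_add)
  have "integral\<^sup>L lborel ?g = integral\<^sup>L lborel ?h + integral\<^sup>L lborel (\<lambda>x. (-1) ^ j * ?h (- x))"
    by (subst g) (rule Bochner_Integration.integral_add[OF int int'])
  also have "integral\<^sup>L lborel (\<lambda>x. (-1) ^ j * ?h (- x)) = (-1) ^ j * integral\<^sup>L lborel ?h"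
    using lborel_integral_real_affine[of "-1" ?h 0] by simp
  also have "integral\<^sup>L lborel ?h = half_moment m t ?a"
    unfolding h half_moment_def set_lebesgue_integral_def ..
  finally show "integral\<^sup>L lborel ?g = (1 + (-1) ^ j) * half_moment m t ?a"
    by (simp add: algebra_simps)
qed

section \<open>The moment functional and integration by parts\<close>

definition weight_functional :: "(real \<Rightarrow> real) \<Rightarrow> real poly \<Rightarrow> real" where
  "weight_functional w p = (\<integral>x. poly p x * w x \<partial>lborel)"

lemma poly_freud_integrable:
  assumes "m \<ge> 1" "t m > 0" "lam > -1"
  shows "integrable lborel (\<lambda>x. poly p x * freud_weight m t lam x)"
proof -
  have "(\<lambda>x. poly p x * freud_weight m t lam x)
      = (\<lambda>x. \<Sum>i\<le>degree p. coeff p i * (x ^ i * freud_weight m t lam x))"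
    by (simp add: poly_altdef sum_distrib_right mult.assoc)
  then show ?thesis
    using freud_moment(1)[where m = m and t = t, OF assms] by simp
qed

lemma weight_functional_add:
  assumes "m \<ge> 1" "t m > 0" "lam > -1"
  shows "weight_functional (freud_weight m t lam) (p + q)
    = weight_functional (freud_weight m t lam) p + weight_functional (freud_weight m t lam) q"
  using poly_freud_integrable[where m = m and t = t, OF assms]
  by (simp add: weight_functional_def distrib_right)

lemma weight_functional_smult: "weight_functional w (smult c p) = c * weight_functional w p"
  by (simp add: weight_functional_def mult.assoc)

text \<open>A non-negative integrand with integral 0 vanishes almost everywhere. Off the origin the
  weight is positive, and a nonzero \<open>p\<close> has only finitely many roots.\<close>

lemma weight_functional_definite:
  assumes "m \<ge> 1" "t m > 0" "lam > -1"
    and "weight_functional (freud_weight m t lam) (p * p) = 0"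
  shows "p = 0"
proof (rule ccontr)
  assume "p \<noteq> 0"
  let ?w = "freud_weight m t lam"
  have "AE x in lborel. poly (p * p) x * ?w x = 0"
    using assms(4) poly_freud_integrable[where m = m and t = t, OF assms(1-3), of "p * p"]
    unfolding weight_functional_def
    by (subst (asm) integral_nonneg_eq_0_iff_AE) (auto simp: freud_weight_def)
  moreover have "AE x in lborel. x \<notin> insert 0 {x. poly p x = 0}"
    using poly_roots_finite[OF \<open>p \<noteq> 0\<close>] by (intro AE_not_in finite_imp_null_set_lborel) simp
  ultimately have "AE x in (lborel :: real measure). False"
  proof eventually_elim
    case (elim x)
    then show ?case using freud_weight_pos[of x m t lam] by auto
  qed
  then show False
    using ae_filter_eq_bot_iff[of "lborel :: real measure"] by (simp add: trivial_limit_def)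
qed

lemma weight_functional_reflect:
  assumes "\<And>x. w (- x) = w x"
  shows "weight_functional w (p \<circ>\<^sub>p [:0, -1:]) = weight_functional w p"
  unfolding weight_functional_def
  using lborel_integral_real_affine[of "-1" "\<lambda>x. poly p x * w x" 0]
  by (simp add: poly_pcompose assms)

lemma additive_poly_eq_0:
  fixes E :: "real poly \<Rightarrow> real"
  assumes add: "\<And>p q. E (p + q) = E p + E q" and monom: "\<And>c i. E (monom c i) = 0"
  shows "E p = 0"
proof -
  have E_0: "E 0 = 0" using monom[of 0 0] by simp
  have "E (\<Sum>i\<in>A. monom (c i) i) = 0" if "finite A" for A c
    using that by (induction A rule: finite_induct) (simp_all add: add monom E_0)
  from this[of "{..degree p}" "coeff p"] show ?thesis
    by (simp add: poly_as_sum_of_monoms)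
qed

text \<open>The logarithmic derivative of the weight is \<open>(2 * lam + 1) / x - V' x\<close>,
  with \<open>V\<close> the potential. The identity says that \<open>x * q * w\<close> has a
  derivative of integral 0; the factor \<open>x\<close> clears the pole. On monomials it reduces to
  \<open>half_moment_rec\<close>.\<close>

lemma freud_integration_by_parts:
  assumes m: "m \<ge> 1" "t m > 0" and lam: "lam > -1"
  defines "L \<equiv> weight_functional (freud_weight m t lam)"
  shows "L (pderiv ([:0, 1:] * q)) + (2 * lam + 1) * L q
    = (\<Sum>k=1..m. 2 * real k * t k * L ([:0, 1:] ^ (2 * k) * q))"
proof -
  define E where "E q = L (pderiv ([:0, 1:] * q)) + (2 * lam + 1) * L q
    - (\<Sum>k=1..m. 2 * real k * t k * L ([:0, 1:] ^ (2 * k) * q))" for q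
  have L_add: "L (p + q) = L p + L q" for p q
    unfolding L_def by (rule weight_functional_add[where m = m and t = t, OF m lam])
  have L_monom: "L (monom c j) = c * ((1 + (-1) ^ j) * half_moment m t (real j + (2 * lam + 1)))" for c j
    unfolding L_def weight_functional_def
    using freud_moment(2)[where m = m and t = t, OF m lam, of j] by (simp add: poly_monom mult.assoc)
  have X_power: "[:0, 1:] ^ i * monom c j = monom c (i + j)" for i j and c :: real
    by (simp flip: monom_altdef[of 1, simplified] add: mult_monom)
  have "E q = 0"
  proof (rule additive_poly_eq_0)
    fix p q show "E (p + q) = E p + E q"
      unfolding E_def by (simp add: distrib_left pderiv_add L_add sum.distrib del: mult_pCons_left)
  next
    fix c :: real and j :: nat
    let ?a = "real j + (2 * lam + 1)" and ?e = "1 + (-1) ^ j :: real"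
    have "[:0, 1:] * monom c j = monom c (Suc j)"
      using X_power[of 1 c j] by simp
    then have "pderiv ([:0, 1:] * monom c j) = monom (real (Suc j) * c) j"
      by (simp add: pderiv_monom)
    then have "L (pderiv ([:0, 1:] * monom c j)) + (2 * lam + 1) * L (monom c j)
        = c * ?e * ((?a + 1) * half_moment m t ?a)"
      by (simp only: L_monom) (simp add: algebra_simps)
    also have "(?a + 1) * half_moment m t ?a = (\<Sum>k=1..m. 2 * real k * t k * half_moment m t (?a + 2 * real k))"
      using m lam by (intro half_moment_rec) auto
    \<comment> \<open>Multiplication by an even power of \<open>x\<close> preserves parity, so all
      moments share the factor \<open>?e\<close>.\<close>
    also have "c * ?e * \<dots> = (\<Sum>k=1..m. 2 * real k * t k * L ([:0, 1:] ^ (2 * k) * monom c j))"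
      unfolding sum_distrib_left X_power L_monom
      by (rule sum.cong) (simp_all add: power_add add_ac mult_ac)
    finally show "E (monom c j) = 0" by (simp add: E_def)
  qed
  then show ?thesis by (simp add: E_def)
qed

subsection \<open>Orthogonal polynomials of an even functional\<close>

text \<open>These are the algebraic properties of the integral that the sequel draws on: linearity,
  definiteness and invariance under reflection.\<close>

locale monic_orthogonal =
  fixes L :: "real poly \<Rightarrow> real" and P :: "nat \<Rightarrow> real poly"
  assumes L_add: "L (p + q) = L p + L q"
    and L_smult: "L (smult c p) = c * L p"
    and L_definite: "L (p * p) = 0 \<Longrightarrow> p = 0"
    and L_reflect: "L (p \<circ>\<^sub>p [:0, -1:]) = L p"
    and degree_P: "degree (P n) = n"
    and monic_P: "lead_coeff (P n) = 1"
    and L_orthogonal: "i \<noteq> j \<Longrightarrow> L (P i * P j) = 0"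
begin

abbreviation X :: "real poly" where "X \<equiv> [:0, 1:]"

definition sqnorm :: "nat \<Rightarrow> real" where
  "sqnorm n = L (P n * P n)"

lemma L_diff: "L (p - q) = L p - L q"
  using L_add[of "p - q" q] by simp

lemma L_0 [simp]: "L 0 = 0"
  using L_add[of 0 0] by simp

lemma coeff_P_degree: "coeff (P n) n = 1"
  using monic_P[of n] by (simp add: degree_P)

lemma P_nonzero: "P n \<noteq> 0"
  using monic_P[of n] by auto

lemma P_0: "P 0 = 1"
proof -
  obtain c where "P 0 = [:c:]" using degree_P[of 0] by (metis degree_eq_zeroE)
  with monic_P[of 0] show ?thesis by (simp add: one_pCons)
qed

lemma sqnorm_nonzero: "sqnorm n \<noteq> 0"
  using L_definite[of "P n"] P_nonzero by (auto simp: sqnorm_def)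

lemma degree_cancel_lead:
  fixes p q :: "real poly"
  assumes "degree p = n" "degree q = n" "coeff p n = coeff q n" "p \<noteq> q"
  shows "degree (p - q) < n"
proof -
  have "degree (p - q) \<le> n" using assms by (simp add: degree_diff_le)
  moreover have "degree (p - q) \<noteq> n"
    using assms by (metis coeff_diff diff_self eq_iff_diff_eq_0 leading_coeff_0_iff)
  ultimately show ?thesis by simp
qed

lemma L_eq_0_if_orthogonal_to_basis:
  assumes "\<And>i. i \<le> N \<Longrightarrow> L (r * P i) = 0" and "degree q \<le> N"
  shows "L (r * q) = 0"
  using assms(2)
proof (induction "degree q" arbitrary: q rule: less_induct)
  case less
  show ?case
  proof (cases "q = smult (lead_coeff q) (P (degree q))")
    case True
    then have "L (r * q) = L (smult (lead_coeff q) (r * P (degree q)))"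
      by (metis mult_smult_right)
    then show ?thesis using assms(1) less.prems by (simp add: L_smult)
  next
    case False
    let ?b = "smult (lead_coeff q) (P (degree q))"
    have "q \<noteq> 0" using False by auto
    then have "degree (q - ?b) < degree q"
      using False by (intro degree_cancel_lead) (auto simp: degree_P coeff_P_degree)
    then have "L (r * (q - ?b)) = 0" using less by auto
    moreover have "L (r * ?b) = 0"
      using assms(1) less.prems by (simp add: L_smult)
    moreover have "r * q = r * (q - ?b) + r * ?b" by (simp add: algebra_simps)
    ultimately show ?thesis by (simp add: L_add del: mult_smult_right)
  qed
qed

text \<open>\<open>r\<close> lies in the span of \<open>P 0, ..., P N\<close>, so it is orthogonal
  to itself and definiteness applies. Polynomial identities are obtained by feeding the difference
  of both sides into this.\<close>

lemma eq_0_if_orthogonal_to_basis: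
  assumes "\<And>i. i \<le> N \<Longrightarrow> L (r * P i) = 0" and "degree r \<le> N"
  shows "r = 0"
  using L_eq_0_if_orthogonal_to_basis[OF assms] L_definite by blast

lemma L_P_lower: "degree q < n \<Longrightarrow> L (P n * q) = 0"
  by (rule L_eq_0_if_orthogonal_to_basis[of "n - 1"]) (auto intro!: L_orthogonal)

lemma L_P_monic:
  assumes "degree q = n" "coeff q n = 1"
  shows "L (P n * q) = sqnorm n"
proof (cases "q = P n")
  case False
  then have "L (P n * (q - P n)) = 0"
    using assms by (intro L_P_lower degree_cancel_lead) (auto simp: degree_P coeff_P_degree)
  then show ?thesis by (simp add: algebra_simps L_diff sqnorm_def)
qed (simp add: sqnorm_def)

lemma reflect_mult: "(p * q) \<circ>\<^sub>p [:0, -1:] = (p \<circ>\<^sub>p [:0, -1:]) * (q \<circ>\<^sub>p [:0, -1::real:])"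
  by (rule pcompose_mult)

lemma reflect_reflect: "(p \<circ>\<^sub>p [:0, -1:]) \<circ>\<^sub>p [:0, -1:] = (p :: real poly)"
  by (simp flip: pcompose_assoc add: pcompose_pCons pcompose_idR)

text \<open>The reflected polynomial, normalised by its sign, is again monic of degree
  \<open>n\<close> and orthogonal to all lower degrees; its difference from \<open>P n\<close> is
  therefore zero.\<close>

lemma P_reflect: "P n \<circ>\<^sub>p [:0, -1:] = smult ((-1) ^ n) (P n)"
proof (cases "n = 0")
  case False
  define p where "p = smult ((-1) ^ n) (P n \<circ>\<^sub>p [:0, -1:])"
  have deg: "degree p = n" by (simp add: p_def degree_P degree_pcompose)
  have "lead_coeff (P n \<circ>\<^sub>p [:0, -1:]) = (-1) ^ n"
    by (subst lead_coeff_comp) (auto simp: degree_P coeff_P_degree)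
  moreover have "degree (P n \<circ>\<^sub>p [:0, -1:]) = n"
    by (simp add: degree_P degree_pcompose)
  ultimately have "coeff (P n \<circ>\<^sub>p [:0, -1:]) n = (-1) ^ n"
    by simp
  then have lead: "coeff p n = 1" by (simp add: p_def flip: power_mult_distrib)
  have "p - P n = 0"
  proof (cases "p = P n")
    case False
    then have lt: "degree (p - P n) < n"
      using deg lead by (intro degree_cancel_lead) (auto simp: degree_P coeff_P_degree)
    show ?thesis
    proof (rule eq_0_if_orthogonal_to_basis[of "n - 1"])
      fix i assume "i \<le> n - 1"
      then have i: "i < n" using \<open>n \<noteq> 0\<close> by simp
      have "L (p * P i) = (-1) ^ n * L (((P n \<circ>\<^sub>p [:0, -1:]) * P i) \<circ>\<^sub>p [:0, -1:])"
        unfolding L_reflect by (simp add: p_def L_smult)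
      also have "\<dots> = (-1) ^ n * L (P n * (P i \<circ>\<^sub>p [:0, -1:]))"
        unfolding reflect_mult reflect_reflect ..
      also have "\<dots> = 0"
        using i by (simp add: L_P_lower degree_P degree_pcompose)
      finally show "L ((p - P n) * P i) = 0"
        using i by (simp add: algebra_simps L_diff L_orthogonal)
    qed (use lt in simp)
  qed simp
  then have "smult ((-1) ^ n) p = smult ((-1) ^ n) (P n)" by simp
  then show ?thesis by (simp add: p_def flip: power_mult_distrib)
qed (simp add: P_0 pcompose_1)

lemma poly_P_0_odd: "odd n \<Longrightarrow> poly (P n) 0 = 0"
  using arg_cong[OF P_reflect[of n], of "\<lambda>p. poly p 0"] by (simp add: poly_pcompose)

lemma L_X_square: "L (X * P n * P n) = 0"
proof -
  have "L (X * P n * P n) = L ((X * P n * P n) \<circ>\<^sub>p [:0, -1:])" by (simp only: L_reflect)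
  also have "(X * P n * P n) \<circ>\<^sub>p [:0, -1:] = smult ((-1) ^ n * (-1) ^ n) (- (X * P n * P n))"
    unfolding reflect_mult P_reflect by (simp add: pcompose_pCons algebra_simps)
  also have "L \<dots> = - L (X * P n * P n)"
    using L_smult[of "-1" "X * P n * P n"] by (simp flip: power_mult_distrib)
  finally show ?thesis by simp
qed

lemma degree_X_mult: "p \<noteq> 0 \<Longrightarrow> degree (X * p) = Suc (degree p)"
  by (subst degree_mult_eq) auto

lemma degree_X_P [simp]: "degree (X * P n) = Suc n"
  using degree_X_mult[OF P_nonzero] degree_P by simp

lemma coeff_X_P: "coeff (X * P n) (Suc n) = 1"
  by (simp add: coeff_P_degree)

text \<open>The remainder has degree at most \<open>n\<close> and is orthogonal to every
  \<open>P i\<close> with \<open>i \<le> n\<close>: by oddness for \<open>i = n\<close>, by the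
  choice of the coefficient for \<open>i = n - 1\<close>, and by degree below that.\<close>

lemma recurrence: "X * P n = P (Suc n) + (if n = 0 then 0 else smult (sqnorm n / sqnorm (n - 1)) (P (n - 1)))"
proof -
  let ?r = "X * P n - P (Suc n) - (if n = 0 then 0 else smult (sqnorm n / sqnorm (n - 1)) (P (n - 1)))"
  have "degree (X * P n - P (Suc n)) \<le> n"
  proof (cases "X * P n = P (Suc n)")
    case False
    then show ?thesis
      using degree_cancel_lead[OF degree_X_P degree_P _ False] by (simp only: coeff_X_P coeff_P_degree less_Suc_eq_le)
  next
    case True
    then show ?thesis by (simp only: diff_self degree_0)
  qed
  then have deg: "degree ?r \<le> n"
    by (rule degree_diff_le) (auto simp: degree_P intro: order.trans[OF degree_smult_le])
  have "?r = 0"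
  proof (rule eq_0_if_orthogonal_to_basis[OF _ deg])
    fix i assume "i \<le> n"
    have L_P: "L (P (Suc n) * P i) = 0" using \<open>i \<le> n\<close> by (intro L_orthogonal) auto
    have "L (?r * P i) = L (X * P n * P i) - (if n = 0 then 0 else sqnorm n / sqnorm (n - 1) * L (P (n - 1) * P i))"
      using L_P unfolding left_diff_distrib L_diff by (cases "n = 0") (auto simp: L_smult simp del: mult_pCons_left)
    also have "\<dots> = 0"
    proof (cases "i = n")
      case True
      then show ?thesis using L_X_square L_orthogonal[of "n - 1" n] by auto
    next
      case False
      then have i: "i < n" using \<open>i \<le> n\<close> by simp
      have comm: "X * P n * P i = P n * (X * P i)" by (simp add: mult_ac)
      show ?thesis
      proof (cases "i = n - 1")
        case True
        then have "L (X * P n * P i) = sqnorm n"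
          unfolding comm using i coeff_X_P[of i] by (intro L_P_monic) (auto simp: degree_P)
        then show ?thesis using True i sqnorm_nonzero[of "n - 1"] by (simp add: sqnorm_def)
      next
        case False
        then have "degree (X * P i) < n" using i degree_X_P[of i] by linarith
        then have "L (X * P n * P i) = 0"
          unfolding comm by (rule L_P_lower)
        then show ?thesis using False L_orthogonal[of "n - 1" i] by auto
      qed
    qed
    finally show "L (?r * P i) = 0" .
  qed
  then show ?thesis by (simp add: algebra_simps)
qed

lemma recurrence_coeff_eq: "n \<ge> 1 \<Longrightarrow> recurrence_coeff P (int n) = sqnorm n / sqnorm (n - 1)"
proof -
  assume n: "n \<ge> 1"
  have "(THE b. X * P n = P (n + 1) + smult b (P (n - 1))) = sqnorm n / sqnorm (n - 1)"
  proof (rule the_equality)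
    show eq: "X * P n = P (n + 1) + smult (sqnorm n / sqnorm (n - 1)) (P (n - 1))"
      using recurrence[of n] n by simp
    fix b assume "X * P n = P (n + 1) + smult b (P (n - 1))"
    then have "smult b (P (n - 1)) = smult (sqnorm n / sqnorm (n - 1)) (P (n - 1))"
      unfolding eq by simp
    then have "smult (b - sqnorm n / sqnorm (n - 1)) (P (n - 1)) = 0"
      by (simp add: smult_diff_left)
    then show "b = sqnorm n / sqnorm (n - 1)" using P_nonzero by simp
  qed
  then show ?thesis using n by (simp add: recurrence_coeff_def)
qed

abbreviation \<beta> :: "int \<Rightarrow> real" where "\<beta> \<equiv> recurrence_coeff P"

lemma sqnorm_Suc: "sqnorm (Suc n) = \<beta> (int n + 1) * sqnorm n"
  using recurrence_coeff_eq[of "Suc n"] sqnorm_nonzero[of n] by (simp add: add.commute)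

text \<open>From a site \<open>n \<ge> 0\<close> a path gets below 0 only through the step down from
  0, whose weight \<open>\<beta> 0\<close> is 0.\<close>

lemma path_weight_below: "j < 0 \<Longrightarrow> path_weight \<beta> k (int n) j = 0"
proof (induction k arbitrary: j)
  case (Suc k)
  then show ?case
    by (cases "j = -1") (auto simp: recurrence_coeff_def)
qed auto

text \<open>Applying one factor \<open>X\<close> to \<open>P j\<close> matches the last step of a
  path. The norm ratio supplies the weight \<open>\<beta> (j + 1)\<close> for a step down, while for
  a step up it cancels to 1.\<close>

lemma L_power_P_P: "L (X ^ k * P n * P j) = sqnorm j * path_weight \<beta> k (int n) (int j)"
proof (induction k arbitrary: j)
  case 0
  then show ?case using L_orthogonal by (auto simp: sqnorm_def)
next
  case (Suc k)
  have "X ^ Suc k * P n * P j = X ^ k * P n * (X * P j)"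
    by (simp only: power_Suc mult_ac)
  also have "\<dots> = X ^ k * P n * P (Suc j)
      + (if j = 0 then 0 else smult (sqnorm j / sqnorm (j - 1)) (X ^ k * P n * P (j - 1)))"
    by (subst recurrence) (simp add: distrib_left del: mult_pCons_left)
  finally have "L (X ^ Suc k * P n * P j) = sqnorm (Suc j) * path_weight \<beta> k (int n) (int (Suc j))
      + (if j = 0 then 0 else sqnorm j / sqnorm (j - 1) * (sqnorm (j - 1) * path_weight \<beta> k (int n) (int (j - 1))))"
    by (simp only: L_add if_distrib[of L] L_smult L_0 Suc.IH)
  also have "\<dots> = sqnorm j * path_weight \<beta> (Suc k) (int n) (int j)"
    \<comment> \<open>For \<open>j = 0\<close> the recurrence has no lower term, in agreement with
      the vanishing path weight at \<open>-1\<close>.\<close>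
    using sqnorm_nonzero[of "j - 1"] path_weight_below[of "-1" k n]
    by (cases j) (simp_all add: sqnorm_Suc algebra_simps)
  finally show ?case .
qed

lemma L_pderiv_P_P: "L (pderiv (P (Suc n) * P n)) = real (Suc n) * sqnorm n"
proof -
  \<comment> \<open>Division by \<open>Suc n\<close> makes the derivative monic of degree
    \<open>n\<close>, so that its pairing with \<open>P n\<close> is the squared norm.\<close>
  define q where "q = smult (1 / real (Suc n)) (pderiv (P (Suc n)))"
  have "L (P n * q) = sqnorm n"
    by (rule L_P_monic) (simp_all add: q_def degree_pderiv degree_P coeff_pderiv coeff_P_degree)
  moreover have "P n * pderiv (P (Suc n)) = smult (real (Suc n)) (P n * q)"
    by (simp add: q_def)
  ultimately have "L (P n * pderiv (P (Suc n))) = real (Suc n) * sqnorm n"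
    by (simp only: L_smult)
  moreover have "L (P (Suc n) * pderiv (P n)) = 0"
    by (rule L_P_lower) (simp add: degree_pderiv degree_P)
  ultimately show ?thesis
    by (simp add: pderiv_mult L_add mult.commute)
qed

text \<open>Exactly one of the two polynomials is odd and hence divisible by \<open>X\<close>. If it
  is \<open>P (Suc n)\<close>, the quotient is monic of degree \<open>n\<close> and is paired with
  \<open>P n\<close>; if it is \<open>P n\<close>, the quotient is orthogonal to
  \<open>P (Suc n)\<close>. This is the source of the alternating term.\<close>

lemma P_P_div_X:
  obtains q where "P (Suc n) * P n = X * q" and "L q = (if even n then sqnorm n else 0)"
proof (cases "even n")
  case True
  then have "X dvd P (Suc n)" using poly_P_0_odd[of "Suc n"] by (simp add: poly_eq_0_iff_dvd)
  then obtain r where r: "P (Suc n) = X * r" by (elim dvdE)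
  then have "r \<noteq> 0" using P_nonzero[of "Suc n"] by auto
  then have "degree r = n" using degree_X_mult[of r] degree_P[of "Suc n"] r by simp
  moreover have "coeff r n = 1" using coeff_P_degree[of "Suc n"] r by simp
  ultimately have "L (P n * r) = sqnorm n" by (rule L_P_monic)
  with r True show ?thesis by (intro that[of "P n * r"]) auto
next
  case False
  then have "X dvd P n" using poly_P_0_odd[of n] by (simp add: poly_eq_0_iff_dvd)
  then obtain r where r: "P n = X * r" by (elim dvdE)
  then have "r \<noteq> 0" using P_nonzero[of n] by auto
  then have "degree r < Suc n" using degree_X_mult[of r] degree_P[of n] r by simp
  then have "L (P (Suc n) * r) = 0" by (rule L_P_lower)
  with r False show ?thesis by (intro that[of "P (Suc n) * r"]) (auto simp del: mult_pCons_left simp: mult_ac)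
qed

end

section \<open>The difference equation\<close>

theorem theorem1:
  fixes m n :: nat and t :: "nat \<Rightarrow> real" and lam :: real and P :: "nat \<Rightarrow> real poly"
  assumes "m \<ge> 1" and "t m > 0" and "lam > -1"
    and "monic_orthogonal_polys (freud_weight m t lam) P"
    and "n \<ge> 1"
  shows "(\<Sum>k=1..m. 2 * real k * t k * meval (recurrence_coeff P) (dPI_F k (int n)))
           - (lam + 1 / 2) * (1 - (-1) ^ n) = real n
         \<and> difference_order (\<Sum>k=1..m. mconst (2 * real k * t k) * dPI_F k (int n)) = 2 * int m - 2
         \<and> (\<forall>k\<in>{1..m}. mvars (dPI_F k (int n)) \<subseteq> {int n - int k + 1..int n + int k - 1}
           \<and> (\<forall>mon. Poly_Mapping.lookup (dPI_F k (int n)) mon \<in> \<nat>))"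
proof -
  define L where "L = weight_functional (freud_weight m t lam)"
  interpret monic_orthogonal L P
  proof
    show "L (p + q) = L p + L q" for p q
      unfolding L_def using assms by (intro weight_functional_add)
    show "L (smult c p) = c * L p" for c p
      unfolding L_def by (rule weight_functional_smult)
    show "L (p * p) = 0 \<Longrightarrow> p = 0" for p
      unfolding L_def using assms weight_functional_definite[where m = m and t = t and lam = lam] by blast
    show "L (p \<circ>\<^sub>p [:0, -1:]) = L p" for p
      unfolding L_def by (rule weight_functional_reflect) (rule freud_weight_reflect)
    show "degree (P i) = i" "lead_coeff (P i) = 1" for i
      using assms(4) unfolding monic_orthogonal_polys_def by blast+
    show "L (P i * P j) = 0" if "i \<noteq> j" for i j
      using assms(4) that by (simp add: monic_orthogonal_polys_def L_def weight_functional_def)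
  qed
  obtain l where n: "n = Suc l" using assms(5) by (cases n) auto
  obtain q where q: "P (Suc l) * P l = X * q" and Lq: "L q = (if even l then sqnorm l else 0)"
    using P_P_div_X by blast
  have power: "L (X ^ (2 * k) * q) = sqnorm l * meval \<beta> (dPI_F k (int n))" if "k \<ge> 1" for k
  proof -
    have "X ^ (2 * k) * q = X ^ (2 * k - 1) * (X * q)"
      using that by (cases k) (simp_all add: mult_ac del: mult_pCons_left)
    also have "\<dots> = X ^ (2 * k - 1) * P (Suc l) * P l"
      by (simp only: q[symmetric] mult.assoc)
    also have "L \<dots> = sqnorm l * path_weight \<beta> (2 * k - 1) (int n) (int n - 1)"
      unfolding L_power_P_P by (simp add: n)
    finally show ?thesis using that by (simp only: meval_dPI_F)
  qed
  \<comment> \<open>Integration by parts is applied to \<open>X * q\<close>, the product of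
    \<open>P n\<close> and \<open>P (n - 1)\<close>; dividing by \<open>sqnorm l\<close> then leaves
    the difference equation.\<close>
  have "real n * sqnorm l + (2 * lam + 1) * L q = L (pderiv (X * q)) + (2 * lam + 1) * L q"
    unfolding q[symmetric] L_pderiv_P_P n ..
  also have "\<dots> = (\<Sum>k=1..m. 2 * real k * t k * L (X ^ (2 * k) * q))"
    unfolding L_def using assms by (intro freud_integration_by_parts)
  also have "\<dots> = (\<Sum>k=1..m. 2 * real k * t k * meval \<beta> (dPI_F k (int n))) * sqnorm l"
    unfolding sum_distrib_right by (rule sum.cong[OF refl], subst power) (simp_all only: atLeastAtMost_iff mult_ac)
  finally have "(real n + (2 * lam + 1) * (if even l then 1 else 0)) * sqnorm l
      = (\<Sum>k=1..m. 2 * real k * t k * meval \<beta> (dPI_F k (int n))) * sqnorm l"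
    unfolding Lq by (cases "even l") (simp_all add: distrib_right)
  then have "real n + (2 * lam + 1) * (if even l then 1 else 0)
      = (\<Sum>k=1..m. 2 * real k * t k * meval \<beta> (dPI_F k (int n)))"
    using sqnorm_nonzero[of l] by simp
  \<comment> \<open>\<open>l\<close> is even exactly when \<open>n\<close> is odd, and then
    \<open>1 - (-1) ^ n\<close> is 2.\<close>
  then have "(\<Sum>k=1..m. 2 * real k * t k * meval \<beta> (dPI_F k (int n)))
      - (lam + 1 / 2) * (1 - (-1) ^ n) = real n"
    by (auto simp: n algebra_simps split: if_splits)
  moreover have "difference_order (\<Sum>k=1..m. mconst (2 * real k * t k) * dPI_F k (int n)) = 2 * int m - 2"
    using assms by (intro difference_order_combination) auto
  moreover have "mvars (dPI_F k (int n)) \<subseteq> {int n - int k + 1..int n + int k - 1}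
      \<and> (\<forall>mon. Poly_Mapping.lookup (dPI_F k (int n)) mon \<in> \<nat>)" if "k \<in> {1..m}" for k
    using that mvars_dPI_F lookup_dPI_F_Nats by auto
  ultimately show ?thesis by blast
qed

end
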